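(* For all complex $t$ with $|t|\ge4$ and $|\operatorname{Re} t|\ge1$, $$|\vartheta(t)|\le 2|t|\log|t|.$$
   Context: Let $\chi(s)=\dfrac{(2\pi)^s}{2\Gamma(s)\cos\frac{\pi s}{2}}$, a meromorphic function on $\mathbf{C}$ (the factor in the functional equation $\zeta(s)=\chi(s)\zeta(1-s)$), with zeros at $0,-2,-4,\dots$ and poles at $1,3,5,\dots$, and $\chi(1/2)=1$. Let $\log\chi(s)$ be the analytic branch on $\mathbf{C}\smallsetminus\bigl((-\infty,0]\cup[1,\infty)\bigr)$ with $\log\chi(1/2)=0$. The Riemann–Siegel theta function is $$\vartheta(t)=-\frac{1}{2i}\log\chi(\tfrac12+it),$$ analytic for $t$ in $\mathbf{C}$ minus the two cuts $i[1/2,\infty)$ and $-i[1/2,\infty)$ along the imaginary axis. *)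

theory Defs
  imports "HOL-Complex_Analysis.Complex_Analysis"
begin

text \<open>
  The formula is the literal one. In HOL it takes the value 0 wherever a denominator
  vanishes or \<open>Gamma\<close> has a pole, so at the negative odd integers (removable
  singularities) it does not agree with the meromorphic function. All these
  points lie on the cuts removed below, so they do not affect \<open>log_chi\<close> or \<open>theta\<close>.
\<close>
definition chi :: "complex \<Rightarrow> complex" where
  "chi s = complex_of_real (2 * pi) powr s / (2 * Gamma s * cos (complex_of_real pi * s / 2))"

definition chi_domain :: "complex set" where
  "chi_domain = - (complex_of_real ` ({..0} \<union> {1..}))"

definition is_log_chi :: "(complex \<Rightarrow> complex) \<Rightarrow> bool" where
  "is_log_chi f \<longleftrightarrow>
     f holomorphic_on chi_domain \<and> (\<forall>s\<in>chi_domain. exp (f s) = chi s) \<and> f (1/2) = 0"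

text \<open>
  Existence and uniqueness (on \<open>chi_domain\<close>) of the branch are the lemmas
  \<open>is_log_chi_log_chi\<close> and \<open>is_log_chi_unique\<close>; off \<open>chi_domain\<close> the values are unspecified.
\<close>
definition log_chi :: "complex \<Rightarrow> complex" where
  "log_chi = (SOME f. is_log_chi f)"

definition theta :: "complex \<Rightarrow> complex" where
  "theta t = - (1 / (2 * \<i>)) * log_chi (1/2 + \<i> * t)"

lemma chi_domain_iff: "s \<in> chi_domain \<longleftrightarrow> Im s \<noteq> 0 \<or> 0 < Re s \<and> Re s < 1"
proof -
  have "s \<in> complex_of_real ` A \<longleftrightarrow> Im s = 0 \<and> Re s \<in> A" for A
    by (auto simp: image_iff complex_eq_iff)
  then show ?thesis unfolding chi_domain_def by auto
qed

lemma half_in_chi_domain: "1/2 \<in> chi_domain"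
  by (simp add: chi_domain_iff)

lemma open_chi_domain: "open chi_domain"
proof -
  have "chi_domain = {s. Im s < 0} \<union> {s. Im s > 0} \<union> ({s. 0 < Re s} \<inter> {s. Re s < 1})"
    by (auto simp: chi_domain_iff)
  also have "open \<dots>"
    by (intro open_Un open_Int open_halfspace_Im_lt open_halfspace_Im_gt
        open_halfspace_Re_lt open_halfspace_Re_gt)
  finally show ?thesis .
qed

lemma simply_connected_chi_domain: "simply_connected chi_domain"
  unfolding chi_domain_def by (rule simply_connected_doubly_slotted_complex_plane) simp

lemma chi_domain_not_nonpos_Ints: "s \<in> chi_domain \<Longrightarrow> s \<notin> \<int>\<^sub>\<le>\<^sub>0"
  by (auto simp: chi_domain_iff elim!: nonpos_Ints_cases)

lemma chi_domain_cos_nonzero: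
  assumes "s \<in> chi_domain"
  shows "cos (complex_of_real pi * s / 2) \<noteq> 0"
proof
  assume "cos (complex_of_real pi * s / 2) = 0"
  then obtain n :: int where n: "complex_of_real pi * s / 2 = of_int n * of_real pi + of_real pi / 2"
    unfolding cos_eq_0 by auto
  have "complex_of_real pi * s = complex_of_real pi * of_int (2 * n + 1)"
    using n by (simp add: field_simps)
  then have "s = of_int (2 * n + 1)"
    by (simp only: mult_cancel_left) simp
  then show False using assms by (auto simp: chi_domain_iff)
qed

lemma holomorphic_chi: "chi holomorphic_on chi_domain"
  unfolding chi_def
  using chi_domain_cos_nonzero chi_domain_not_nonpos_Ints
  by (intro holomorphic_intros) (auto simp: Gamma_eq_zero_iff)

lemma chi_nonzero: "s \<in> chi_domain \<Longrightarrow> chi s \<noteq> 0"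
  using chi_domain_cos_nonzero[of s] chi_domain_not_nonpos_Ints[of s]
  by (simp add: chi_def Gamma_eq_zero_iff)

lemma chi_half: "chi (1/2) = 1"
proof -
  have "complex_of_real (2 * pi) powr (1/2) = complex_of_real ((2 * pi) powr (1/2))"
    by (simp add: powr_of_real[symmetric])
  also have "\<dots> = complex_of_real (sqrt 2 * sqrt pi)"
    by (simp only: real_sqrt_mult[symmetric]) (simp add: powr_half_sqrt)
  finally have 1: "complex_of_real (2 * pi) powr (1/2) = complex_of_real (sqrt 2 * sqrt pi)" .
  have 2: "cos (complex_of_real pi * (1/2) / 2) = complex_of_real (sqrt 2 / 2)"
    using cos_of_real[of "pi / 4", where 'a = complex] by (simp add: cos_45)
  have "chi (1/2) =
      complex_of_real (sqrt 2 * sqrt pi) / (2 * of_real (sqrt pi) * of_real (sqrt 2 / 2))"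
    unfolding chi_def 1 2 Gamma_one_half_complex ..
  also have "\<dots> = complex_of_real ((sqrt 2 * sqrt pi) / (2 * sqrt pi * (sqrt 2 / 2)))"
    by simp
  also have "\<dots> = 1" by simp
  finally show ?thesis .
qed

lemma is_log_chi_exists: "\<exists>f. is_log_chi f"
proof -
  obtain g where g: "g holomorphic_on chi_domain" "\<And>s. s \<in> chi_domain \<Longrightarrow> chi s = exp (g s)"
    using simply_connected_chi_domain holomorphic_chi chi_nonzero
    unfolding simply_connected_eq_holomorphic_log[OF open_chi_domain] by metis
  have "exp (g (1/2)) = 1" using g(2)[OF half_in_chi_domain] chi_half by simp
  then have "is_log_chi (\<lambda>s. g s - g (1/2))"
    unfolding is_log_chi_def using g by (auto intro!: holomorphic_intros simp: exp_diff)
  then show ?thesis by blast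
qed

lemma is_log_chi_log_chi: "is_log_chi log_chi"
  unfolding log_chi_def using is_log_chi_exists by (rule someI_ex)

lemma is_log_chi_unique:
  assumes f: "is_log_chi f" and g: "is_log_chi g" and s: "s \<in> chi_domain"
  shows "f s = g s"
proof -
  define h where "h = (\<lambda>s. f s - g s)"
  have cont: "continuous_on chi_domain h"
    using f g unfolding h_def is_log_chi_def
    by (intro continuous_intros holomorphic_on_imp_continuous_on) auto
  have exp1: "exp (h z) = 1" if "z \<in> chi_domain" for z
    using f g that chi_nonzero[OF that] by (simp add: h_def is_log_chi_def exp_diff)
  have disc: "\<exists>e>0. \<forall>y. y \<in> chi_domain \<and> h y \<noteq> h x \<longrightarrow> e \<le> norm (h y - h x)"
    if x: "x \<in> chi_domain" for x
  proof (intro exI[of _ "2 * pi"] conjI allI impI)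
    fix y assume y: "y \<in> chi_domain \<and> h y \<noteq> h x"
    have "exp (h y) = exp (h x)" using exp1 x y by simp
    then obtain n :: int where n: "h y = h x + complex_of_real (of_int (2 * n) * pi) * \<i>"
      unfolding exp_eq by auto
    with y have "n \<noteq> 0" by auto
    then have "1 \<le> \<bar>real_of_int n\<bar>" by linarith
    then have "2 * pi \<le> norm (complex_of_real (of_int (2 * n) * pi) * \<i>)"
      unfolding norm_mult norm_of_real by (simp add: abs_mult)
    then show "2 * pi \<le> norm (h y - h x)" using n by simp
  qed simp
  have "h constant_on chi_domain"
    by (rule continuous_discrete_range_constant[OF _ cont])
       (use disc simply_connected_chi_domain simply_connected_imp_connected in auto)
  then have "h s = h (1/2)"
    using s half_in_chi_domain by (metis constant_on_def)
  then show ?thesis using f g by (simp add: h_def is_log_chi_def)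
qed

end

theory Submission
  imports Defs
begin

text \<open>
  Put \<open>s = 1/2 + \<i> t\<close>. The relations \<open>chi s * chi (1 - s) = 1\<close> and \<open>chi (cnj s) = cnj (chi s)\<close>
  reduce the claim to \<open>Re t \<ge> 1\<close> and \<open>Im t \<le> 0\<close>, so that \<open>Re s \<ge> 1/2\<close> and \<open>Im s \<ge> 1\<close>.
  In the upper half-plane \<open>log_chi s\<close> is \<open>s ln (2 \<pi>) + \<i> \<pi> s / 2 - ln_Gamma s\<close> up to the small
  term \<open>Ln (1 + exp (\<i> \<pi> s))\<close>. Inserting Stirling's formula with a bounded remainder
  leaves \<open>\<i> t (ln (2 \<pi>) + 1 - Ln s + \<i> \<pi> / 2)\<close> plus bounded terms, and the constant 2
  has enough slack for the triangle inequality.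
\<close>

section \<open>Stirling's approximation of \<open>ln_Gamma\<close> in the right half-plane\<close>

text \<open>With the denominators dropped, the tail of the logarithm series is geometric. A cubic
  remainder is required because \<open>norm_stirling_step_le\<close> divides it by \<open>w\<close>
  and must still be left with order two.\<close>

lemma Ln_approx_quadratic:
  fixes z :: complex
  assumes "norm z < 1"
  shows "norm (Ln (1 + z) - (z - z\<^sup>2 / 2)) \<le> norm z ^ 3 / (1 - norm z)"
proof -
  let ?f = "\<lambda>n. - ((- z) ^ n) / of_nat n"
  have "?f sums Ln (1 + z)"
    using assms by (rule Ln_series')
  \<comment> \<open>The term \<open>n = 0\<close> is \<open>- 1 / 0 = 0\<close>, so the three terms
    split off are 0, \<open>z\<close> and \<open>- z\<^sup>2 / 2\<close>.\<close>
  from sums_split_initial_segment[OF this, of 3]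
  have sums: "(\<lambda>i. ?f (i + 3)) sums (Ln (1 + z) - (z - z\<^sup>2 / 2))"
    by (simp add: eval_nat_numeral algebra_simps)
  have bound: "norm (?f (i + 3)) \<le> norm z ^ 3 * norm z ^ i" for i
  proof -
    have "norm (?f (i + 3)) = norm z ^ (i + 3) / real (i + 3)"
      by (simp add: norm_divide norm_power del: of_nat_add)
    also have "\<dots> \<le> norm z ^ (i + 3) / 1"
      by (intro divide_left_mono) auto
    finally show ?thesis by (simp add: power_add mult_ac)
  qed
  have geom: "(\<lambda>i. norm z ^ 3 * norm z ^ i) sums (norm z ^ 3 * (1 / (1 - norm z)))"
    using assms by (intro sums_mult geometric_sums) simp
  have "norm (\<Sum>i. ?f (i + 3)) \<le> (\<Sum>i. norm z ^ 3 * norm z ^ i)"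
    by (rule norm_suminf_le[OF bound sums_summable[OF geom]])
  then show ?thesis
    using sums geom by (simp add: sums_iff)
qed

text \<open>Stirling's main term without the constant \<open>ln (2 * pi) / 2\<close>, which the
  bounded remainder absorbs.\<close>

definition stirling_main :: "complex \<Rightarrow> complex" where
  "stirling_main z = (z - 1/2) * Ln z - z"

text \<open>The defect of \<open>stirling_main\<close> in the recurrence
  \<open>ln_Gamma (z + 1) = ln_Gamma z + Ln z\<close>.\<close>

definition stirling_step :: "complex \<Rightarrow> complex" where
  "stirling_step z = (z + 1/2) * (Ln (z + 1) - Ln z) - 1"

lemma stirling_main_plus1:
  "stirling_main (z + 1) - stirling_main z = Ln z + stirling_step z"
  by (simp add: stirling_main_def stirling_step_def field_simps)

text \<open>Both arguments lie strictly between \<open>- pi / 2\<close> and \<open>pi / 2\<close>,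
  so their difference stays in the principal strip.\<close>

lemma Ln_diff_eq_Ln_1_plus:
  assumes "Re z > 0" "Re w > 0"
  shows "Ln w - Ln z = Ln (w / z)"
proof -
  have "w \<noteq> 0" "z \<noteq> 0" using assms by auto
  moreover have "\<bar>Im (Ln w - Ln z)\<bar> < pi"
    using Re_Ln_pos_lt_imp[OF assms(1)] Re_Ln_pos_lt_imp[OF assms(2)] by simp
  ultimately show ?thesis
    by (intro Ln_unique[symmetric]) (auto simp: exp_diff)
qed

text \<open>In powers of \<open>w = 1 / z\<close> the constant and linear terms cancel, leaving a
  defect of order two, which is summable along \<open>z + k\<close>.\<close>

lemma norm_stirling_step_le:
  assumes "norm z \<ge> 4" "Re z > 0"
  shows "norm (stirling_step z) \<le> 7 / 4 / norm z ^ 2"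
proof -
  define w where "w = 1 / z"
  have "z \<noteq> 0" using assms by auto
  then have w: "z = 1 / w" "w \<noteq> 0" by (auto simp: w_def)
  have nw: "norm w = 1 / norm z" by (simp add: w_def norm_divide)
  have w4: "norm w \<le> 1 / 4" using assms by (simp add: nw divide_simps)
  define r where "r = Ln (1 + w) - (w - w\<^sup>2 / 2)"
  have "norm r \<le> norm w ^ 3 / (1 - norm w)"
    unfolding r_def using w4 by (intro Ln_approx_quadratic) auto
  also have "\<dots> \<le> norm w ^ 3 / (3 / 4)"
    using w4 by (intro divide_left_mono) auto
  finally have r: "norm r \<le> 4 / 3 * norm w ^ 3" by simp
  have "Ln (z + 1) - Ln z = Ln (1 + w)"
    using assms \<open>z \<noteq> 0\<close> by (subst Ln_diff_eq_Ln_1_plus) (auto simp: w_def add_divide_distrib add.commute)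
  then have "stirling_step z = (1 / w + 1 / 2) * (w - w\<^sup>2 / 2 + r) - 1"
    by (simp add: stirling_step_def r_def w(1))
  also have "\<dots> = r / w - w\<^sup>2 / 4 + r / 2"
    using w(2) by (simp add: field_simps power2_eq_square)
  also have "norm \<dots> \<le> norm r / norm w + norm w ^ 2 / 4 + norm r / 2"
    by (rule order_trans[OF norm_triangle_ineq]
        add_mono order_trans[OF norm_triangle_ineq4])+ (auto simp: norm_divide norm_power)
  also have "\<dots> \<le> (4 / 3 * norm w ^ 3) / norm w + norm w ^ 2 / 4 + (4 / 3 * norm w ^ 3) / 2"
    using r by (intro add_mono divide_right_mono) auto
  also have "\<dots> = (19 / 12 + 2 / 3 * norm w) * norm w ^ 2"
    using w(2) by (simp add: field_simps power2_eq_square power3_eq_cube)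
  \<comment> \<open>19/12 + (2/3) * (1/4) = 7/4.\<close>
  also have "\<dots> \<le> 7 / 4 * norm w ^ 2"
    using w4 by (intro mult_right_mono) auto
  finally show ?thesis by (simp add: nw power_divide)
qed

text \<open>As \<open>Re z > 0\<close>, the squared norm of \<open>z + k\<close> is at least
  \<open>16 + k^2\<close>. This dominates half of \<open>(k + 3) * (k + 4)\<close>, whose
  reciprocals telescope, so the bound is uniform in \<open>n\<close>.\<close>

lemma sum_stirling_step_le:
  assumes "norm z \<ge> 4" "Re z > 0"
  shows "norm (\<Sum>k\<le>n. stirling_step (z + of_nat k)) \<le> 7 / 6"
proof -
  have step: "norm (stirling_step (z + of_nat k)) \<le> 7 / 2 * (1 / real (k + 3) - 1 / real (k + 4))" for k
  proof -
    have "16 \<le> norm z ^ 2"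
      using power_mono[OF assms(1), of 2] by simp
    then have n2: "norm (z + of_nat k) ^ 2 \<ge> 16 + real k ^ 2"
      using mult_nonneg_nonneg[OF less_imp_le[OF assms(2)], of "real k"]
      unfolding cmod_power2 by (simp add: power2_eq_square algebra_simps)
    have n16: "16 \<le> norm (z + of_nat k) ^ 2"
      using n2 zero_le_power2[of "real k"] by linarith
    then have "4 ^ 2 \<le> norm (z + of_nat k) ^ 2" by simp
    then have n4: "4 \<le> norm (z + of_nat k)" by (rule power2_le_imp_le) simp
    \<comment> \<open>The next inequality amounts to \<open>k^2 - 7 * k + 20 >= 0\<close>;
      completing the square proves it.\<close>
    have "0 \<le> (real k - 7 / 2) ^ 2" by simp
    then have "real (k + 3) * real (k + 4) \<le> 2 * (16 + real k ^ 2)"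
      by (simp add: power2_eq_square algebra_simps)
    with n2 have kk: "real (k + 3) * real (k + 4) / 2 \<le> norm (z + of_nat k) ^ 2" by simp
    have "norm (stirling_step (z + of_nat k)) \<le> 7 / 4 / norm (z + of_nat k) ^ 2"
      using n4 assms by (intro norm_stirling_step_le) auto
    also have "\<dots> \<le> 7 / 4 / (real (k + 3) * real (k + 4) / 2)"
    proof (intro divide_left_mono mult_pos_pos kk)
      show "0 < norm (z + of_nat k) ^ 2" using n16 by linarith
    qed auto
    also have "\<dots> = 7 / 2 * (1 / real (k + 3) - 1 / real (k + 4))"
      by (simp add: field_simps)
    finally show ?thesis .
  qed
  have "norm (\<Sum>k\<le>n. stirling_step (z + of_nat k)) \<le> (\<Sum>k\<le>n. 7 / 2 * (1 / real (k + 3) - 1 / real (k + 4)))"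
    by (rule sum_norm_le) (rule step)
  also have "\<dots> = 7 / 2 * (1 / 3 - 1 / real (n + 4))"
    using sum_telescope[of "\<lambda>k. 1 / real (k + 3)" n]
    unfolding sum_distrib_left[symmetric] by (simp add: add_ac)
  also have "\<dots> \<le> 7 / 6" by simp
  finally show ?thesis .
qed

text \<open>Each \<open>Ln (z + k)\<close> is an increment of \<open>stirling_main\<close> minus its
  defect, so the sum of logarithms telescopes.\<close>

lemma ln_Gamma_series_eq_stirling:
  assumes "Re z > 0"
  shows "ln_Gamma_series z n = z * ln (of_nat n) + ln (fact n) + stirling_main z
           + (\<Sum>k\<le>n. stirling_step (z + of_nat k)) - stirling_main (of_nat n + (z + 1))"
proof -
  have "ln_Gamma_series z n = z * ln (of_nat n) + ln (fact n) - (\<Sum>k\<le>n. Ln (z + of_nat k))"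
  proof -
    have "Ln (z / of_nat k + 1) = Ln (z + of_nat k) - of_real (ln (real k))" if "k \<ge> 1" for k
    proof -
      have "Ln (z + of_nat k) - Ln (of_nat k) = Ln ((z + of_nat k) / of_nat k)"
        using assms that by (intro Ln_diff_eq_Ln_1_plus) auto
      then show ?thesis using that by (simp add: add_divide_distrib)
    qed
    then have "(\<Sum>k=1..n. Ln (z / of_nat k + 1)) = (\<Sum>k=1..n. Ln (z + of_nat k) - of_real (ln (real k)))"
      by (intro sum.cong) auto
    also have "\<dots> = (\<Sum>k=1..n. Ln (z + of_nat k)) - of_real (ln (fact n))"
    proof -
      have "ln (fact n :: real) = (\<Sum>k=1..n. ln (real k))"
        by (induction n) (simp_all add: ln_mult)
      then show ?thesis by (simp add: sum_subtractf)
    qed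
    also have "of_real (ln (fact n)) = (ln (fact n) :: complex)"
      using Ln_of_real[of "fact n"] by simp
    also have "(\<Sum>k=1..n. Ln (z + of_nat k)) = (\<Sum>k\<le>n. Ln (z + of_nat k)) - Ln z"
    proof -
      have "{..n} = insert 0 {1..n}" by auto
      then show ?thesis by simp
    qed
    finally show ?thesis by (simp add: ln_Gamma_series_def)
  qed
  also have "(\<Sum>k\<le>n. Ln (z + of_nat k)) =
    (\<Sum>k\<le>n. stirling_main (z + of_nat (Suc k)) - stirling_main (z + of_nat k) - stirling_step (z + of_nat k))"
  proof (intro sum.cong refl)
    fix k
    show "Ln (z + of_nat k) =
      stirling_main (z + of_nat (Suc k)) - stirling_main (z + of_nat k) - stirling_step (z + of_nat k)"
      using stirling_main_plus1[of "z + of_nat k"] by (simp add: add_ac)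
  qed
  also have "\<dots> = stirling_main (of_nat n + (z + 1)) - stirling_main z - (\<Sum>k\<le>n. stirling_step (z + of_nat k))"
  proof -
    have "(\<Sum>k\<le>n. stirling_main (z + of_nat (Suc k)) - stirling_main (z + of_nat k)) =
            stirling_main (of_nat n + (z + 1)) - stirling_main z"
      using sum_telescope[of "\<lambda>k. - stirling_main (z + of_nat k)" n] by (simp add: add_ac)
    then show ?thesis by (simp only: sum_subtractf)
  qed
  finally show ?thesis by (simp add: algebra_simps)
qed

text \<open>This is the derivative of \<open>Ln (1 + a * h)\<close> at \<open>h = 0\<close>, sampled
  at \<open>h = 1 / n\<close>.\<close>

lemma tendsto_of_nat_mult_Ln_1_plus:
  fixes a :: complex
  shows "(\<lambda>n. of_nat n * Ln (1 + a / of_nat n)) \<longlonglongrightarrow> a"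
proof -
  have "((\<lambda>h. Ln (1 + a * h)) has_field_derivative a) (at 0)"
    by (auto intro!: derivative_eq_intros)
  then have "((\<lambda>h. Ln (1 + a * h) / h) \<longlongrightarrow> a) (at 0)"
    by (simp add: DERIV_def)
  moreover have "filterlim (\<lambda>n. inverse (of_nat n :: complex)) (at 0) sequentially"
    by (intro filterlim_atI lim_inverse_n eventually_mono[OF eventually_gt_at_top[of 0]]) auto
  ultimately have "(\<lambda>n. Ln (1 + a * inverse (of_nat n)) / inverse (of_nat n)) \<longlonglongrightarrow> a"
    by (rule filterlim_compose)
  then show ?thesis by (simp add: divide_inverse mult.commute)
qed

text \<open>Writing \<open>Ln (n + a) = ln n + Ln (1 + a / n)\<close> reduces the difference to
  \<open>(n + a - 1/2) * Ln (1 + a / n) - a\<close>. This handles the end term of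
  \<open>ln_Gamma_series_eq_stirling\<close>.\<close>

lemma tendsto_stirling_main:
  fixes a :: complex
  shows "(\<lambda>n. stirling_main (of_nat n + a) - ((of_nat n + a - 1/2) * ln (of_nat n) - of_nat n)) \<longlonglongrightarrow> 0"
proof -
  have "(\<lambda>n. 1 + a / of_nat n) \<longlonglongrightarrow> 1 + 0"
    by (intro tendsto_intros lim_const_over_n)
  then have Ln: "(\<lambda>n. Ln (1 + a / of_nat n)) \<longlonglongrightarrow> Ln 1"
    by (intro tendsto_Ln) auto
  have "(\<lambda>n. of_nat n * Ln (1 + a / of_nat n) + (a - 1/2) * Ln (1 + a / of_nat n) - a)
      \<longlonglongrightarrow> a + (a - 1/2) * Ln 1 - a"
    by (intro tendsto_add tendsto_diff tendsto_mult tendsto_const Ln tendsto_of_nat_mult_Ln_1_plus)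
  then have lim: "(\<lambda>n. of_nat n * Ln (1 + a / of_nat n) + (a - 1/2) * Ln (1 + a / of_nat n) - a) \<longlonglongrightarrow> 0"
    by simp
  have "eventually (\<lambda>n. real n > norm a) sequentially"
    using filterlim_at_top_dense filterlim_real_sequentially by blast
  then have "\<forall>\<^sub>F n in sequentially.
      of_nat n * Ln (1 + a / of_nat n) + (a - 1/2) * Ln (1 + a / of_nat n) - a =
      stirling_main (of_nat n + a) - ((of_nat n + a - 1/2) * ln (of_nat n) - of_nat n)"
  proof eventually_elim
    case (elim n)
    have n: "real n > 0" using elim norm_ge_zero[of a] by linarith
    have "of_nat n + a \<noteq> 0"
      using elim by (metis add_eq_0_iff norm_minus_cancel norm_of_nat order_less_irrefl)
    then have nz: "1 + a / of_nat n \<noteq> 0" using n by (simp add: field_simps)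
    have "of_nat n + a = of_nat n * (1 + a / of_nat n)" using n by (simp add: field_simps)
    then have "Ln (of_nat n + a) = ln (of_nat n) + Ln (1 + a / of_nat n)"
      using Ln_times_of_nat[of n "1 + a / of_nat n"] n nz by simp
    then show ?case unfolding stirling_main_def by (simp add: algebra_simps)
  qed
  with lim show ?thesis by (rule Lim_transform_eventually)
qed

text \<open>
  Comparing \<open>z\<close> with the base point 4, where \<open>ln_Gamma\<close> is known, cancels \<open>ln (fact n)\<close>,
  so that neither Stirling's formula for the factorial nor its constant is needed.
\<close>
lemma ln_Gamma_stirling:
  assumes "norm z \<ge> 4" "Re z > 0"
  shows "norm (ln_Gamma z - stirling_main z) \<le> 11 / 3"
proof -
  define C where "C = ln_Gamma (4 :: complex) - stirling_main 4"
  define X where "X = (\<lambda>z n. ln_Gamma_series z n - stirling_main z)"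
  define D where "D = (\<lambda>z n. \<Sum>k\<le>n. stirling_step (z + of_nat k))"
  define R where "R = (\<lambda>a n. stirling_main (of_nat n + a)
                    - ((of_nat n + a - 1/2) * ln (of_nat n) - of_nat n))"
  have X: "X z \<longlonglongrightarrow> ln_Gamma z - stirling_main z" if "Re z > 0" for z
  proof -
    have "z \<notin> \<int>\<^sub>\<le>\<^sub>0" using that by (auto elim!: nonpos_Ints_cases)
    then show ?thesis unfolding X_def by (intro tendsto_intros ln_Gamma_complex_LIMSEQ)
  qed
  \<comment> \<open>Up to \<open>D\<close> and \<open>R\<close>, \<open>X z n\<close> equals
    \<open>ln (fact n) - (n + 1/2) * ln n + n\<close>, which is free of \<open>z\<close> and
    cancels.\<close>
  have XD: "X z n - X 4 n = D z n - D 4 n - (R (z + 1) n - R 5 n)" for n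
    by (simp add: X_def D_def R_def ln_Gamma_series_eq_stirling assms algebra_simps)
  have R: "R a \<longlonglongrightarrow> 0" for a
    unfolding R_def by (rule tendsto_stirling_main)
  have "(\<lambda>n. X z n - X 4 n + (R (z + 1) n - R 5 n)) \<longlonglongrightarrow> (ln_Gamma z - stirling_main z - C) + (0 - 0)"
    unfolding C_def using assms by (intro tendsto_intros X R) auto
  then have "(\<lambda>n. D z n - D 4 n) \<longlonglongrightarrow> ln_Gamma z - stirling_main z - C"
    by (simp add: XD)
  moreover have "norm (D z n - D 4 n) \<le> 7 / 3" for n
    using norm_triangle_ineq4[of "D z n" "D 4 n"] sum_stirling_step_le[OF assms, of n]
      sum_stirling_step_le[of 4 n] by (simp add: D_def)
  ultimately have 1: "norm (ln_Gamma z - stirling_main z - C) \<le> 7 / 3"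
    by (intro Lim_norm_ubound[of sequentially]) auto
  have C: "C = of_real (ln 6 - 7 * ln 2 + 4)"
  proof -
    have "ln_Gamma (4 :: complex) = of_real (ln 6)"
      using ln_Gamma_complex_conv_fact[of 4] Ln_of_real[of 6] by (simp add: fact_numeral)
    moreover have "Ln 4 = of_real (2 * ln 2)"
      using Ln_of_real[of 4] ln_realpow[of 2 2] by simp
    ultimately show ?thesis by (simp add: C_def stirling_main_def)
  qed
  \<comment> \<open>Placing 6 between 4 and 8 puts \<open>C\<close> between
    \<open>4 - 5 * ln 2\<close> and \<open>4 - 4 * ln 2\<close>; the total is then 4/3 + 7/3 =
    11/3.\<close>
  have "ln (6::real) \<le> ln (2 ^ 3)" "ln (2 ^ 2 :: real) \<le> ln (6 :: real)" by (subst ln_le_cancel_iff; simp)+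
  then have "ln (6::real) \<le> 3 * ln 2" "2 * ln (2 :: real) \<le> ln 6" by (simp_all only: ln_realpow)
  then have "norm C \<le> 4 / 3"
    unfolding C norm_of_real using ln2_ge_two_thirds ln2_le_25_over_36 by linarith
  with 1 show ?thesis using norm_triangle_sub[of "ln_Gamma z - stirling_main z" C] by simp
qed

section \<open>Uniqueness of logarithms; symmetries of \<open>chi\<close>, \<open>log_chi\<close>
  and \<open>theta\<close>\<close>

text \<open>The difference takes values in the discrete set of multiples of
  \<open>2 * pi * \<i>\<close>, hence is constant on a connected set.\<close>

lemma continuous_log_unique:
  fixes f g :: "complex \<Rightarrow> complex"
  assumes "connected S" "continuous_on S f" "continuous_on S g"
    and eq: "\<And>z. z \<in> S \<Longrightarrow> exp (f z) = exp (g z)"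
    and "a \<in> S" "f a = g a" "z \<in> S"
  shows "f z = g z"
proof -
  define h where "h = (\<lambda>z. f z - g z)"
  have "h constant_on S"
  proof (rule continuous_discrete_range_constant[OF \<open>connected S\<close>])
    show "continuous_on S h"
      unfolding h_def by (intro continuous_intros assms)
    fix x assume x: "x \<in> S"
    show "\<exists>e>0. \<forall>y. y \<in> S \<and> h y \<noteq> h x \<longrightarrow> e \<le> norm (h y - h x)"
    proof (intro exI[of _ "2 * pi"] conjI allI impI)
      fix y assume y: "y \<in> S \<and> h y \<noteq> h x"
      have "exp (h y) = exp (h x)"
        using eq x y by (simp add: h_def exp_diff)
      then obtain n :: int where n: "h y = h x + complex_of_real (of_int (2 * n) * pi) * \<i>"
        unfolding exp_eq by auto
      with y have "n \<noteq> 0" by auto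
      then have "1 \<le> \<bar>real_of_int n\<bar>" by linarith
      then have "2 * pi \<le> norm (complex_of_real (of_int (2 * n) * pi) * \<i>)"
        unfolding norm_mult norm_of_real by (simp add: abs_mult)
      then show "2 * pi \<le> norm (h y - h x)" using n by simp
    qed simp
  qed
  then have "h z = h a"
    using assms by (metis constant_on_def)
  then show ?thesis using assms by (simp add: h_def)
qed

lemma log_chi_half: "log_chi (1/2) = 0"
  and exp_log_chi: "s \<in> chi_domain \<Longrightarrow> exp (log_chi s) = chi s"
  and holomorphic_log_chi: "log_chi holomorphic_on chi_domain"
  using is_log_chi_log_chi unfolding is_log_chi_def by auto

text \<open>Euler's reflection formula for \<open>Gamma\<close> meets the double-angle formula for
  the sine.\<close>

lemma chi_reflect:
  assumes "s \<in> chi_domain"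
  shows "chi (1 - s) = inverse (chi s)"
proof -
  have 1: "1 - s \<in> chi_domain" using assms by (auto simp: chi_domain_iff)
  note nz = chi_domain_cos_nonzero[OF assms] chi_domain_cos_nonzero[OF 1]
  have powr: "complex_of_real (2 * pi) powr s * complex_of_real (2 * pi) powr (1 - s) = of_real (2 * pi)"
    by (subst powr_add[symmetric]) simp
  have cos1: "cos (complex_of_real pi * (1 - s) / 2) = sin (complex_of_real pi * s / 2)"
    by (simp add: cos_sin_eq right_diff_distrib diff_divide_distrib)
  have sin: "sin (complex_of_real pi * s) =
      2 * sin (complex_of_real pi * s / 2) * cos (complex_of_real pi * s / 2)"
    using sin_double[of "complex_of_real pi * s / 2"] by simp
  have mult: "(2 * a * c) * (2 * b * d) = 4 * (a * b) * (c * d)" for a b c d :: complex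
    by simp
  have "chi s * chi (1 - s) = of_real (2 * pi) /
      (4 * (Gamma s * Gamma (1 - s)) * (cos (complex_of_real pi * s / 2) * sin (complex_of_real pi * s / 2)))"
    unfolding chi_def cos1 times_divide_times_eq mult powr ..
  also have "\<dots> = 1"
    using nz unfolding cos1 Gamma_reflection_complex sin by simp
  finally show ?thesis by (metis inverse_unique)
qed

lemma chi_cnj: "chi (cnj s) = cnj (chi s)"
proof -
  have "Ln (complex_of_real (2 * pi)) = of_real (ln (2 * pi))"
    by (rule Ln_of_real) simp
  then have "complex_of_real (2 * pi) powr cnj s = cnj (complex_of_real (2 * pi) powr s)"
    by (simp add: powr_def exp_cnj del: of_real_mult)
  moreover have "cos (complex_of_real pi * cnj s / 2) = cnj (cos (complex_of_real pi * s / 2))"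
    by (simp add: cnj_cos)
  ultimately show ?thesis
    unfolding chi_def by (simp only: cnj_Gamma[symmetric] complex_cnj_divide complex_cnj_mult complex_cnj_numeral)
qed

text \<open>The map \<open>s\<close> to \<open>1 - s\<close> fixes \<open>1/2\<close>, so the
  negated reflected branch has the same normalisation and uniqueness applies.\<close>

lemma log_chi_reflect:
  assumes "s \<in> chi_domain"
  shows "log_chi (1 - s) = - log_chi s"
proof -
  have refl: "1 - s \<in> chi_domain" if "s \<in> chi_domain" for s
    using that by (auto simp: chi_domain_iff)
  have "is_log_chi (\<lambda>s. - log_chi (1 - s))"
    unfolding is_log_chi_def
  proof (intro conjI ballI)
    have "(log_chi \<circ> (\<lambda>s. 1 - s)) holomorphic_on chi_domain"
      by (rule holomorphic_on_compose_gen[OF _ holomorphic_log_chi])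
        (auto intro!: holomorphic_intros refl)
    then show "(\<lambda>s. - log_chi (1 - s)) holomorphic_on chi_domain"
      by (simp add: o_def holomorphic_on_minus)
    show "exp (- log_chi (1 - s)) = chi s" if "s \<in> chi_domain" for s
      using that refl[OF that] by (simp add: exp_minus exp_log_chi chi_reflect)
  qed (simp add: log_chi_half)
  from is_log_chi_unique[OF is_log_chi_log_chi this assms] show ?thesis by simp
qed

lemma log_chi_cnj:
  assumes "s \<in> chi_domain"
  shows "log_chi (cnj s) = cnj (log_chi s)"
proof -
  have cnj: "cnj s \<in> chi_domain" if "s \<in> chi_domain" for s
    using that by (auto simp: chi_domain_iff)
  have img: "cnj ` chi_domain = chi_domain"
    using cnj by (force simp: image_iff intro: bexI[of _ "cnj _"])
  have "is_log_chi (cnj \<circ> log_chi \<circ> cnj)"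
    unfolding is_log_chi_def
    using holomorphic_on_compose_cnj_cnj[of log_chi chi_domain]
    by (auto simp: img holomorphic_log_chi open_chi_domain log_chi_half exp_log_chi cnj chi_cnj
        simp flip: exp_cnj)
  from is_log_chi_unique[OF is_log_chi_log_chi this assms] show ?thesis by simp
qed

lemma theta_minus:
  assumes "Re t \<noteq> 0"
  shows "theta (- t) = - theta t"
proof -
  have "1/2 + \<i> * (- t) = 1 - (1/2 + \<i> * t)" by simp
  then show ?thesis
    using assms unfolding theta_def by (simp only:) (subst log_chi_reflect, auto simp: chi_domain_iff)
qed

text \<open>Conjugating \<open>t\<close> sends \<open>s\<close> to \<open>1 - cnj s\<close>, so both
  symmetries of \<open>log_chi\<close> enter; the sign from the reflection is absorbed by
  conjugating \<open>1 / (2 * \<i>)\<close>.\<close>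

lemma theta_cnj:
  assumes "Re t \<noteq> 0"
  shows "theta (cnj t) = cnj (theta t)"
proof -
  have dom: "1/2 + \<i> * t \<in> chi_domain" "1 - (1/2 + \<i> * t) \<in> chi_domain"
    using assms by (auto simp: chi_domain_iff)
  have "1/2 + \<i> * cnj t = cnj (1 - (1/2 + \<i> * t))" by simp
  then have "log_chi (1/2 + \<i> * cnj t) = - cnj (log_chi (1/2 + \<i> * t))"
    using dom by (simp only: log_chi_cnj log_chi_reflect complex_cnj_minus)
  then show ?thesis by (simp add: theta_def)
qed

section \<open>\<open>log_chi\<close> in terms of \<open>ln_Gamma\<close>\<close>

text \<open>Factoring \<open>exp (- \<i> * pi * s / 2)\<close> out of the cosine makes the right
  side a logarithm of \<open>chi\<close>; comparing at \<open>1/2\<close> fixes the branch.\<close>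

lemma log_chi_eq_ln_Gamma:
  assumes "Im s > 0"
  shows "log_chi s = s * of_real (ln (2 * pi)) + \<i> * pi * s / 2 - ln_Gamma s - Ln (1 + exp (\<i> * pi * s))"
proof -
  \<comment> \<open>The strip is adjoined because \<open>1/2\<close> is only a boundary point of the
    upper half-plane.\<close>
  define U where "U = {s. Im s > 0} \<union> ({s. Re s > 0} \<inter> {s. Re s < 1})"
  define f where
    "f = (\<lambda>s::complex. s * of_real (ln (2 * pi)) + \<i> * pi * s / 2 - ln_Gamma s - Ln (1 + exp (\<i> * pi * s)))"
  have U_dom: "U \<subseteq> chi_domain" by (auto simp: U_def chi_domain_iff)
  have "connected U"
    unfolding U_def
  proof (rule connected_Un)
    have "Complex (1/2) 1 \<in> {s. Im s > 0} \<inter> ({s. Re s > 0} \<inter> {s. Re s < 1})" by simp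
    then show "{s. Im s > 0} \<inter> ({s. Re s > 0} \<inter> {s. Re s < 1}) \<noteq> {}" by blast
  qed (intro convex_connected convex_Int convex_halfspace_Im_gt convex_halfspace_Re_gt
      convex_halfspace_Re_lt)+
  \<comment> \<open>Above the real axis the exponential has norm below 1; in the rest of the strip
    its imaginary part is positive.\<close>
  have slit: "1 + exp (\<i> * pi * s) \<notin> \<real>\<^sub>\<le>\<^sub>0" if "s \<in> U" for s
  proof (cases "Im s > 0")
    case True
    have "- Re (exp (\<i> * pi * s)) \<le> norm (exp (\<i> * pi * s))"
      using abs_Re_le_cmod[of "exp (\<i> * pi * s)"] by linarith
    also have "\<dots> < 1" using True by simp
    finally show ?thesis by (simp add: complex_nonpos_Reals_iff)
  next
    case False
    then have "0 < sin (pi * Re s)"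
      using that by (intro sin_gt_zero) (auto simp: U_def)
    then have "Im (1 + exp (\<i> * pi * s)) > 0" by (simp add: Im_exp)
    then show ?thesis by (simp add: complex_nonpos_Reals_iff)
  qed
  have Gamma_slit: "s \<notin> \<real>\<^sub>\<le>\<^sub>0" if "s \<in> U" for s
    using that by (auto simp: U_def complex_nonpos_Reals_iff)
  have cont_f: "continuous_on U f"
    unfolding f_def using slit Gamma_slit by (intro continuous_intros) auto
  have exp_f: "exp (f s) = chi s" if "s \<in> U" for s
  proof -
    have nz: "1 + exp (\<i> * pi * s) \<noteq> 0" using slit[OF that] by force
    have Gamma: "exp (ln_Gamma s) = Gamma s"
      using chi_domain_not_nonpos_Ints U_dom that by (auto simp: Gamma_complex_altdef)
    have powr: "exp (s * of_real (ln (2 * pi))) = complex_of_real (2 * pi) powr s"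
      by (simp add: powr_def Ln_of_real flip: of_real_mult)
    have cos: "cos (complex_of_real pi * s / 2) = exp (- (\<i> * pi * s / 2)) * (1 + exp (\<i> * pi * s)) / 2"
    proof -
      define x where "x = \<i> * pi * s / 2"
      have half: "\<i> * (complex_of_real pi * s / 2) = x" and full: "\<i> * pi * s = x + x"
        by (simp_all add: x_def)
      show ?thesis
        unfolding cos_exp_eq half x_def[symmetric] unfolding full exp_add exp_minus
        by (simp add: field_simps)
    qed
    have alg: "p * e / g / w = p / (2 * g * (inverse e * w / 2))" if "e \<noteq> 0" for p e g w :: complex
      using that by (simp add: field_simps)
    show ?thesis
      unfolding f_def chi_def exp_diff exp_add powr Gamma exp_Ln[OF nz] cos exp_minus
      by (rule alg) simp
  qed
  have f_half: "f (1/2) = 0"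
  proof -
    have "exp (\<i> * pi * (1/2)) = \<i>" by (simp add: exp_eq_polar cis_conv_exp[symmetric])
    moreover have "ln_Gamma (1/2 :: complex) = of_real (ln pi / 2)"
      using ln_Gamma_complex_of_real[of "1/2"]
      by (simp add: ln_Gamma_real_pos Gamma_one_half_real ln_sqrt)
    moreover have "Ln (1 + \<i>) = of_real (ln 2 / 2) + \<i> * pi / 4"
    proof (rule Ln_unique)
      have "exp (complex_of_real (ln 2 / 2)) = of_real (sqrt 2)"
        by (simp only: exp_of_real ln_sqrt[symmetric]) simp
      moreover have "exp (\<i> * pi / 4) = Complex (sqrt 2 / 2) (sqrt 2 / 2)"
        using cis_conv_exp[of "pi / 4"] by (simp add: cis.ctr cos_45 sin_45)
      ultimately show "exp (complex_of_real (ln 2 / 2) + \<i> * pi / 4) = 1 + \<i>"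
        by (simp only: exp_add) (simp add: complex_eq_iff)
    qed auto
    ultimately show ?thesis
      by (simp add: f_def ln_mult algebra_simps)
  qed
  have "log_chi s = f s"
  proof (rule continuous_log_unique[OF \<open>connected U\<close> _ cont_f])
    show "continuous_on U log_chi"
      using holomorphic_log_chi U_dom
      by (meson continuous_on_subset holomorphic_on_imp_continuous_on)
    show "exp (log_chi z) = exp (f z)" if "z \<in> U" for z
      using that U_dom by (auto simp: exp_f exp_log_chi)
    show "1/2 \<in> U" "s \<in> U" using assms by (auto simp: U_def)
  qed (simp add: f_half log_chi_half)
  then show ?thesis by (simp add: f_def)
qed

section \<open>The estimate in one quadrant and its extension by symmetry\<close>

lemma norm_theta_le_quadrant:
  assumes "norm t \<ge> 4" "Re t \<ge> 1" "Im t \<le> 0"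
  shows "norm (theta t) \<le> 2 * norm t * ln (norm t)"
proof -
  define s where "s = 1/2 + \<i> * t"
  define L where "L = ln (norm t)"
  \<comment> \<open>\<open>A\<close> and \<open>B\<close> come from expanding the main terms of
    \<open>log_chi s\<close> in powers of \<open>s - 1/2\<close>, with \<open>Ln s\<close> kept as a
    coefficient.\<close>
  define A where "A = of_real (ln (2 * pi) + 1) - Ln s + \<i> * pi / 2"
  define B where "B = of_real (ln (2 * pi) / 2 + 1 / 2) + \<i> * pi / 4"
  define E where "E = ln_Gamma s - stirling_main s"
  define e where "e = Ln (1 + exp (\<i> * pi * s))"
  have s: "Re s = 1/2 - Im t" "Im s = Re t" by (simp_all add: s_def)
  have t_pos: "0 < norm t" using assms by linarith
  have s_nz: "s \<noteq> 0" using s assms by auto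
  have "norm t ^ 2 \<le> norm s ^ 2"
    unfolding cmod_power2 s using assms by (simp add: power2_eq_square algebra_simps)
  then have ns1: "norm t \<le> norm s" by (rule power2_le_imp_le) simp
  have ns2: "norm s \<le> 2 * norm t"
    unfolding s_def using assms norm_triangle_ineq[of "1/2" "\<i> * t"] by (simp add: norm_mult)
  have ln4: "ln (4::real) = 2 * ln 2" using ln_realpow[of 2 2] by simp
  have "ln 4 \<le> L" unfolding L_def using assms by (subst ln_le_cancel_iff) auto
  then have L: "4 / 3 \<le> L" using ln4 ln2_ge_two_thirds by linarith
  have "Re A = ln (2 * pi) + 1 - ln (norm s)" using s_nz by (simp add: A_def)
  moreover have "L \<le> ln (norm s)" unfolding L_def using ns1 assms by (subst ln_le_cancel_iff) auto
  moreover have "ln (norm s) \<le> ln (2 * norm t)" using ns2 s_nz assms by (subst ln_le_cancel_iff) auto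
  then have "ln (norm s) \<le> ln 2 + L"
    using ln_mult_pos[of 2 "norm t"] t_pos by (simp add: L_def)
  moreover have "ln 2 \<le> ln (2 * pi)" using pi_gt3 by (subst ln_le_cancel_iff) auto
  moreover have "ln (2 * pi) \<le> ln (2 ^ 3)" using pi_less_4 by (subst ln_le_cancel_iff) auto
  then have ln2pi: "ln (2 * pi) \<le> 3 * ln 2" by (simp only: ln_realpow)
  \<comment> \<open>\<open>Re A\<close> is at most \<open>3 * ln 2 + 1 - L\<close> and at least
    \<open>1 - L\<close>; the first is the tight side, at \<open>L = 4/3\<close>.\<close>
  ultimately have ReA: "\<bar>Re A\<bar> \<le> 132 / 100 * L"
    using L ln2_le_25_over_36 by linarith
  have pi: "pi \<le> 22 / 7" using pi_approx by simp
  have "0 < Im (Ln s)" "Im (Ln s) < pi / 2"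
    using Im_Ln_pos_lt_imp[of s] Re_Ln_pos_lt_imp[of s] s assms by auto
  \<comment> \<open>\<open>Im A\<close> lies between 0 and \<open>pi / 2 <= 11/7\<close>, just below
    (118/100) * (4/3).\<close>
  then have ImA: "\<bar>Im A\<bar> \<le> 118 / 100 * L"
    using pi L by (simp add: A_def)
  have A: "norm A \<le> 5 / 2 * L"
    using cmod_le[of A] ReA ImA by linarith
  have "0 \<le> ln (2 * pi)" using pi_gt3 by simp
  then have "norm B \<le> ln (2 * pi) / 2 + 1 / 2 + pi / 4"
    using cmod_le[of B] by (simp add: B_def)
  then have B: "norm B \<le> 7 / 3"
    using ln2pi ln2_le_25_over_36 pi by linarith
  have E: "norm E \<le> 11 / 3"
    unfolding E_def using assms ns1 s by (intro ln_Gamma_stirling) auto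
  have "norm (exp (\<i> * pi * s)) = exp (- (pi * Re t))" by (simp add: s)
  also have "\<dots> \<le> exp (- 3)"
    using assms pi_gt3 mult_mono[of 3 pi 1 "Re t"] by simp
  also have "\<dots> \<le> 1 / 4"
    using exp_ge_add_one_self[of "3 :: real"] by (simp add: exp_minus divide_simps)
  finally have small: "norm (exp (\<i> * pi * s)) \<le> 1 / 4" .
  then have e: "norm e \<le> 1 / 2"
    unfolding e_def using norm_Ln_le[of "exp (\<i> * pi * s)"] by linarith
  have "log_chi s = s * of_real (ln (2 * pi)) + \<i> * pi * s / 2 - ln_Gamma s - e"
    unfolding e_def using s assms by (intro log_chi_eq_ln_Gamma) auto
  also have "\<dots> = (s - 1/2) * A + B - E - e"
    by (simp add: A_def B_def E_def stirling_main_def field_simps)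
  also have "s - 1/2 = \<i> * t" by (simp add: s_def)
  finally have "norm (log_chi s) = norm (\<i> * t * A + B - E - e)" by simp
  also have "\<dots> \<le> norm (\<i> * t * A) + norm B + norm E + norm e"
    by (intro order_trans[OF norm_triangle_ineq4] add_mono norm_triangle_ineq order_refl)
  also have "\<dots> \<le> norm t * (5 / 2 * L) + 7 / 3 + 11 / 3 + 1 / 2"
    using mult_left_mono[OF A, of "norm t"] by (intro add_mono B E e) (simp add: norm_mult)
  \<comment> \<open>The constants sum to 13/2, while the spare \<open>3/2 * norm t * L\<close> is at
    least (3/2) * 4 * (4/3) = 8. The factor 4 is halved in \<open>theta\<close>.\<close>
  also have "\<dots> \<le> 4 * (norm t * L)"
    using mult_mono[OF assms(1) L] by simp
  finally show ?thesis
    by (simp add: theta_def norm_divide norm_mult s_def[symmetric] L_def)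
qed

theorem proposition5:
  fixes t :: complex
  assumes "norm t \<ge> 4" and "\<bar>Re t\<bar> \<ge> 1"
  shows "norm (theta t) \<le> 2 * norm t * ln (norm t)"
proof -
  have pos: "norm (theta u) \<le> 2 * norm u * ln (norm u)" if "norm u \<ge> 4" "Re u \<ge> 1" for u
  proof (cases "Im u \<le> 0")
    case False
    then show ?thesis
      using that norm_theta_le_quadrant[of "cnj u"] theta_cnj[of u] by simp
  qed (use that in \<open>rule norm_theta_le_quadrant\<close>)
  show ?thesis
  proof (cases "Re t > 0")
    case False
    then show ?thesis
      using assms pos[of "- t"] theta_minus[of t] by auto
  qed (use assms in \<open>intro pos; simp\<close>)
qed

end
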